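(* Let $E\in\mathbb Z_{\ge0}$, let $$I_E=\max\Bigl\{2E+5,\ 1+\bigl\lfloor 33+8\sqrt{E+16}\bigr\rfloor\Bigr\},$$ let $i\ge I_E$ be an integer, and let $A_i=\{a_1<\cdots<a_i\}\subset\mathbb R_{>0}$. Then, for every $e\in\{0,\dots,E\}$, the equality $y_i=e$ holds if and only if there is a unique pair $(t,D)$ with $t>0$ and $$D\subseteq[i+e-1],\qquad |D|=e,$$ such that $$A_i=t\bigl([i+e]\setminus D\bigr).$$ In this representation $a_i=t(i+e)$.
   Context: For a finite set $A\subset\mathbb R_{>0}$, $\mathrm{FS}(A)=\{\sum_{a\in X}a:X\subseteq A\}$ (empty sum included). For an integer $v$, $[v]=\{1,\dots,v\}$ (empty if $v<1$). For $t>0$, $tX=\{tx:x\in X\}$. With $A_{i-1}=\{a_1,\dots,a_{i-1}\}$, the increment excess at $i$ is $$y_i=|\mathrm{FS}(A_i)\setminus\mathrm{FS}(A_{i-1})|-i.$$ *)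

theory Defs
  imports Complex_Main
begin

definition FS :: "real set \<Rightarrow> real set" where
  "FS A = {\<Sum>a\<in>X. a | X. X \<subseteq> A}"

definition dilate :: "real \<Rightarrow> real set \<Rightarrow> real set" where
  "dilate t X = {t * x | x. x \<in> X}"

(* A set A = {a_1 < ... < a_n} is given by its enumeration a (values outside the index
   range are irrelevant); prefix_set a j is A_j, with A_0 empty. *)
definition prefix_set :: "(nat \<Rightarrow> real) \<Rightarrow> nat \<Rightarrow> real set" where
  "prefix_set a j = a ` {1..j}"

(* Integer-valued, so that the subtraction is not truncated. Meaningful for i \<ge> 1. *)
definition increment_excess :: "(nat \<Rightarrow> real) \<Rightarrow> nat \<Rightarrow> int" where
  "increment_excess a i =
     int (card (FS (prefix_set a i) - FS (prefix_set a (i - 1)))) - int i"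

definition threshold :: "nat \<Rightarrow> int" where
  "threshold E = max (2 * int E + 5) (1 + \<lfloor>33 + 8 * sqrt (real E + 16)\<rfloor>)"

end

theory Submission
  imports Defs
begin

text \<open>
  With \<open>B\<close> the first \<open>i - 1\<close> elements and \<open>a\<close> the last one, every class of \<open>FS B\<close> modulo \<open>a\<close>
  yields a new sum (add \<open>a\<close> to its maximum). So a small excess means that \<open>i - 1\<close> distinct
  nontrivial elements of the circle have at most \<open>i + E\<close> subset products. A greedy growth argument
  shows that these products then form a subgroup, of order \<open>m\<close> say, and \<open>B\<close> consists of
  multiples of \<open>a / m\<close>. Conversely, if \<open>B \<subseteq> {1..<m}\<close> has density at least about \<open>2 / 3\<close>, then all
  integers from \<open>m\<close> to \<open>\<Sum>B - m\<close> are subset sums of \<open>B\<close>, so every class modulo \<open>m\<close> is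
  a gapless progression in \<open>FS B\<close> and yields exactly one new sum. This also gives \<open>m = i + e\<close>.
\<close>

section \<open>Subset sums of dense sets of integers\<close>

text \<open>Pigeonhole: the part of \<open>B\<close> in \<open>{z<..y}\<close> and its mirror image
  under w -> y + z + 1 - w share two elements. The mirror fixes at most one of them; the other, with
  its image, is the pair.\<close>

lemma two_elements_with_reflected_sum:
  fixes B :: "nat set"
  assumes "z \<le> y" and "2 * card (B \<inter> {z<..y}) \<ge> y - z + 2"
  obtains p q where "p \<in> B" "q \<in> B" "z < p" "p < q" "q \<le> y" "p + q = y + z + 1"
proof -
  let ?S = "B \<inter> {z<..y}"
  define r where "r = (\<lambda>i. y + z + 1 - i)"
  have inj: "inj_on r ?S" by (auto simp: inj_on_def r_def)
  have sub: "?S \<union> r ` ?S \<subseteq> {z<..y}" by (auto simp: r_def)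
  have "card ?S + card (r ` ?S) = card (?S \<union> r ` ?S) + card (?S \<inter> r ` ?S)"
    by (rule card_Un_Int) auto
  moreover have "card (?S \<union> r ` ?S) \<le> y - z"
    using card_mono[OF _ sub] by simp
  ultimately have "card (?S \<inter> r ` ?S) \<ge> 2"
    using assms card_image[OF inj] by linarith
  then have "\<not> card (?S \<inter> r ` ?S) \<le> 1" by simp
  then obtain u v where uv: "u \<in> ?S \<inter> r ` ?S" "v \<in> ?S \<inter> r ` ?S" "u \<noteq> v"
    by (metis One_nat_def card_le_Suc0_iff_eq finite_Int finite_greaterThanAtMost)
  have "\<exists>w \<in> ?S \<inter> r ` ?S. 2 * w \<noteq> y + z + 1"
    using uv by (metis nat_mult_eq_cancel1 zero_less_numeral)
  then obtain w w' where w: "w \<in> ?S" "w' \<in> ?S" "w = r w'" "2 * w \<noteq> y + z + 1" by blast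
  have "w + w' = y + z + 1" using w by (auto simp: r_def)
  then show ?thesis
    using that[of w w'] that[of w' w] w by (cases w w' rule: linorder_cases) auto
qed

text \<open>
  Greedy removal of the largest elements leaves a remainder \<open>\<rho>\<close>. Depending on whether \<open>B\<close> has
  density above one half below \<open>\<rho>\<close>, either \<open>\<rho>\<close> or \<open>y + \<rho>\<close>, where \<open>y\<close> is the element
  removed last, is a sum of two elements that are still available.
\<close>

lemma dense_subset_sums_lower_half:
  fixes B :: "nat set"
  assumes BL: "B \<subseteq> {1..L}" and dense: "card B \<ge> 2 * (L - card B) + 4"
    and x_ge: "\<And>b. b \<in> B \<Longrightarrow> b \<le> x" and x_le: "2 * x \<le> \<Sum>B"
  shows "x \<in> sum (\<lambda>x. x) ` Pow B"
proof -
  have fin: "finite B" using BL finite_subset by blast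
  have ne: "B \<noteq> {}" using dense by auto
  \<comment> \<open>\<open>U y\<close> is what the greedy choice has taken on reaching
    \<open>y\<close>; \<open>Y\<close> collects the stages that still fit into \<open>x\<close>, so
    \<open>Min Y\<close> is the element taken last.\<close>
  define U where "U = (\<lambda>y. B \<inter> {y..})"
  define Y where "Y = {y \<in> B. \<Sum>(U y) \<le> x}"
  have "U (Max B) = {Max B}" using Max_in[OF fin ne] Max_ge[OF fin] by (force simp: U_def)
  then have "Max B \<in> Y" using Max_in[OF fin ne] x_ge by (auto simp: Y_def)
  then have Yne: "Y \<noteq> {}" by auto
  have finY: "finite Y" using fin by (simp add: Y_def)
  define y where "y = Min Y"
  have yY: "y \<in> Y" and ymin: "\<And>w. w \<in> Y \<Longrightarrow> y \<le> w"
    using Min_in[OF finY Yne] Min_le[OF finY] by (auto simp: y_def)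
  have yB: "y \<in> B" and yx: "\<Sum>(U y) \<le> x" using yY by (auto simp: Y_def)
  have y1: "y \<ge> 1" using yB BL by auto
  define \<beta> where "\<beta> = card (B \<inter> {1..y})"
  have split: "B = (B \<inter> {..<y}) \<union> U y" by (auto simp: U_def)
  have sumsplit: "\<Sum>B = \<Sum>(B \<inter> {..<y}) + \<Sum>(U y)"
    by (subst split, rule sum.union_disjoint) (auto simp: fin U_def)
  have cardsplit: "card B = card (B \<inter> {..<y}) + card (U y)"
    by (subst split, rule card_Un_disjoint) (auto simp: fin U_def)
  have "B \<inter> {1..y} = insert y (B \<inter> {..<y})" using yB BL by force
  then have \<beta>: "\<beta> = card (B \<inter> {..<y}) + 1" by (simp add: \<beta>_def fin)
  \<comment> \<open>Otherwise the bound on the gaps gives \<open>2 * \<beta> \<le> card B\<close>,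
    so \<open>U y\<close> has more elements than lie below \<open>y\<close>, all of them larger. It
    would carry more than half of \<open>\<Sum>B\<close>, against
    \<open>2 * x \<le> \<Sum>B\<close>.\<close>
  have \<beta>_big: "2 * \<beta> \<ge> y + 3"
  proof (rule ccontr)
    assume "\<not> 2 * \<beta> \<ge> y + 3"
    moreover have "y - \<beta> \<le> L - card B"
    proof -
      have "card ({1..y} - B) \<le> card ({1..L} - B)"
        by (rule card_mono) (use yB BL in auto)
      moreover have "card ({1..L} - B) = L - card B"
        using BL fin by (simp add: card_Diff_subset)
      moreover have "card ({1..y} - B) = y - \<beta>"
        by (simp add: \<beta>_def card_Diff_subset_Int Int_commute)
      ultimately show ?thesis by simp
    qed
    ultimately have le: "2 * \<beta> \<le> card B" using dense by linarith
    have "\<Sum>(B \<inter> {..<y}) \<le> card (B \<inter> {..<y}) * y"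
      using sum_bounded_above[of "B \<inter> {..<y}" "\<lambda>x. x" y] by auto
    also have "\<dots> < card (U y) * y"
      using le \<beta> cardsplit y1 by auto
    also have "\<dots> \<le> \<Sum>(U y)"
      using sum_bounded_below[of "U y" y "\<lambda>x. x"] by (auto simp: U_def)
    finally show False using x_le yx sumsplit by linarith
  qed
  define \<rho> where "\<rho> = x - \<Sum>(U y)"
  have x: "x = \<Sum>(U y) + \<rho>" using yx by (simp add: \<rho>_def)
  have "B \<inter> {..<y} \<noteq> {}" using \<beta> \<beta>_big y1 by auto
  then have lowne: "B \<inter> {..<y} \<noteq> {}" "finite (B \<inter> {..<y})" using fin by auto
  \<comment> \<open>The next element below \<open>y\<close> no longer fits, which bounds the
    remainder by \<open>\<rho> < y'\<close>.\<close>
  define y' where "y' = Max (B \<inter> {..<y})"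
  have y': "y' \<in> B" "y' < y" and y'max: "\<And>w. w \<in> B \<Longrightarrow> w < y \<Longrightarrow> w \<le> y'"
    using Max_in[OF lowne(2,1)] Max_ge[OF lowne(2)] by (auto simp: y'_def)
  have "U y' = insert y' (U y)" using y' y'max by (force simp: U_def)
  moreover have "y' \<notin> U y" using y' by (auto simp: U_def)
  moreover have "y' \<notin> Y" using ymin y' by force
  ultimately have \<rho>_less: "\<rho> < y'" using y' x fin by (auto simp: Y_def U_def)
  show ?thesis
  proof (cases "\<rho> = 0")
    case True
    then show ?thesis using x by (auto simp: U_def intro!: image_eqI[of _ _ "U y"])
  next
    case False
    \<comment> \<open>The shift makes both targets reflected sums: \<open>\<rho>\<close> on
      \<open>{0<..z}\<close> and \<open>y + \<rho>\<close> on \<open>{z<..y}\<close>. If both counts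
      fell short, \<open>2 * \<beta>\<close> would be at most y + 2.\<close>
    define z where "z = \<rho> - 1"
    have z: "\<rho> = z + 1" using False by (simp add: z_def)
    have zy: "z < y" using z \<rho>_less y' by simp
    show ?thesis
    proof (cases "2 * card (B \<inter> {0<..z}) \<ge> z - 0 + 2")
      case True
      obtain p q where pq: "p \<in> B" "q \<in> B" "0 < p" "p < q" "q \<le> z" "p + q = z + 0 + 1"
        using two_elements_with_reflected_sum[OF _ True] by blast
      let ?X = "insert p (insert q (U y))"
      have "p \<notin> insert q (U y)" "q \<notin> U y" using pq zy by (auto simp: U_def)
      then have "\<Sum>?X = x" using pq x z fin by (simp add: U_def)
      moreover have "?X \<in> Pow B" using pq by (auto simp: U_def)
      ultimately show ?thesis by (metis imageI)
    next
      case False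
      have "B \<inter> {1..y} = (B \<inter> {0<..z}) \<union> (B \<inter> {z<..y})" using zy by auto
      then have "\<beta> = card (B \<inter> {0<..z}) + card (B \<inter> {z<..y})"
        unfolding \<beta>_def by (simp, subst card_Un_disjoint) auto
      then have "2 * card (B \<inter> {z<..y}) \<ge> y - z + 2" using False \<beta>_big zy by linarith
      then obtain p q where pq: "p \<in> B" "q \<in> B" "z < p" "p < q" "q \<le> y" "p + q = y + z + 1"
        using two_elements_with_reflected_sum[of z y B] zy by auto
      let ?V = "U y - {y}"
      have "U y = insert y ?V" using yB by (auto simp: U_def)
      then have "\<Sum>(U y) = y + \<Sum>?V"
        using fin by (metis Diff_iff U_def finite_Diff finite_Int insertI1 sum.insert)
      moreover have "p \<notin> insert q ?V" "q \<notin> ?V" using pq by (auto simp: U_def)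
      ultimately have "\<Sum>(insert p (insert q ?V)) = x" using pq x z fin by (simp add: U_def)
      moreover have "insert p (insert q ?V) \<in> Pow B" using pq by (auto simp: U_def)
      ultimately show ?thesis by (metis imageI)
    qed
  qed
qed

text \<open>Complements in \<open>B\<close> pair the subset sums, so the lower half of the range
  settles the upper half.\<close>

lemma subset_sums_reflect:
  fixes B :: "nat set"
  assumes "finite B" and "x \<le> \<Sum>B" and "\<Sum>B - x \<in> sum (\<lambda>x. x) ` Pow B"
  shows "x \<in> sum (\<lambda>x. x) ` Pow B"
proof -
  obtain X where X: "X \<subseteq> B" "\<Sum>B - x = \<Sum>X" using assms by auto
  have "\<Sum>(B - X) = \<Sum>B - \<Sum>X" using X assms by (intro sum_diff_nat) (auto intro: finite_subset)
  then have "\<Sum>(B - X) = x" using X assms by linarith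
  then show ?thesis by (metis Diff_subset PowI imageI)
qed

lemma dense_subset_sums:
  fixes B :: "nat set"
  assumes BL: "B \<subseteq> {1..L}" and dense: "card B \<ge> 2 * (L - card B) + 4"
    and x: "L \<le> x" "x + L \<le> \<Sum>B"
  shows "x \<in> sum (\<lambda>x. x) ` Pow B"
proof (cases "2 * x \<le> \<Sum>B")
  case True
  show ?thesis
    by (rule dense_subset_sums_lower_half[OF BL dense _ True]) (use BL x in fastforce)
next
  case False
  have "\<Sum>B - x \<in> sum (\<lambda>x. x) ` Pow B"
    by (rule dense_subset_sums_lower_half[OF BL dense]) (use BL x False in fastforce)+
  then show ?thesis
    using subset_sums_reflect BL x by (metis add_leD1 finite_atLeastAtMost finite_subset)
qed

lemma gauss_sum_le_sum_of_card:
  fixes B :: "nat set"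
  assumes "finite B" and "0 \<notin> B"
  shows "card B * (card B + 1) \<le> 2 * \<Sum>B"
  using assms
proof (induction "card B" arbitrary: B)
  case 0
  then show ?case by simp
next
  case (Suc n)
  then have ne: "B \<noteq> {}" by auto
  let ?M = "Max B"
  have MB: "?M \<in> B" using Max_in Suc ne by blast
  have "n * (n + 1) \<le> 2 * \<Sum>(B - {?M})"
    using Suc.hyps(1)[of "B - {?M}"] Suc MB by (metis Diff_iff card_Diff_singleton diff_Suc_1 finite_Diff)
  moreover have "B \<subseteq> {1..?M}"
    using Suc.prems Max_ge[OF Suc.prems(1)] by (auto simp: Suc_le_eq intro: gr0I)
  then have "Suc n \<le> ?M" using card_mono[of "{1..?M}" B] Suc.hyps by auto
  moreover have "\<Sum>B = ?M + \<Sum>(B - {?M})" using MB Suc.prems by (simp add: sum.remove)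
  ultimately show ?case using Suc.hyps(2)[symmetric] by (simp add: algebra_simps)
qed

text \<open>The window \<open>{s - m<..s}\<close> meets each class modulo \<open>m\<close> once.
  Since \<open>F\<close> fills the middle range, sending a window element to the new sum of its
  class is a bijection onto the new sums.\<close>

lemma card_new_subset_sums_dense:
  fixes B :: "nat set"
  assumes BL: "B \<subseteq> {1..<m}" and dense: "card B \<ge> 2 * (m - 1 - card B) + 4"
    and large: "card B \<ge> 9"
  defines "F \<equiv> sum (\<lambda>x. x) ` Pow B"
  shows "card ((+) m ` F - F) = m"
proof -
  have fin: "finite B" using BL finite_subset by blast
  define s where "s = \<Sum>B"
  have Bm: "B \<subseteq> {1..m - 1}" using BL by fastforce
  have cm: "card B \<le> m - 1" using card_mono[OF _ Bm] by simp
  have F_le: "f \<le> s" if "f \<in> F" for f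
    using that fin by (auto simp: F_def s_def intro: sum_mono2)
  have F_mid: "x \<in> F" if "m \<le> x" "x + m \<le> s" for x
    unfolding F_def by (rule dense_subset_sums[OF Bm dense]) (use that in \<open>auto simp: s_def\<close>)
  \<comment> \<open>Window elements then exceed 2m, so subtracting \<open>m\<close> from one lands
    in the middle range.\<close>
  have s_big: "3 * m \<le> s"
  proof -
    have "card B * (card B + 1) \<le> 2 * s"
      unfolding s_def by (rule gauss_sum_le_sum_of_card) (use fin BL in auto)
    moreover have "card B * 10 \<le> card B * (card B + 1)"
      by (rule mult_le_mono2) (use large in simp)
    moreover have "6 * m \<le> card B * 10" using dense cm by linarith
    ultimately show ?thesis by linarith
  qed
  (* \<psi> y is the new sum in the residue class of y, i.e. m plus the largest old sum there. *)
  define \<psi> where "\<psi> = (\<lambda>y. if y \<in> F then y + m else y)"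
  have "(+) m ` F - F = \<psi> ` {s - m<..s}"
  proof (intro equalityI subsetI)
    fix w assume "w \<in> (+) m ` F - F"
    then obtain f where f: "f \<in> F" "w = m + f" "w \<notin> F" by auto
    show "w \<in> \<psi> ` {s - m<..s}"
    proof (cases "w \<le> s")
      case True
      then have "w \<in> {s - m<..s}" using F_mid[of w] f by force
      then show ?thesis using f by (intro image_eqI[of _ _ w]) (auto simp: \<psi>_def)
    next
      case False
      then have "f \<in> {s - m<..s}" using F_le[OF f(1)] f s_big by auto
      then show ?thesis using f by (intro image_eqI[of _ _ f]) (auto simp: \<psi>_def)
    qed
  next
    fix w assume "w \<in> \<psi> ` {s - m<..s}"
    then obtain y where y: "y \<in> {s - m<..s}" "w = \<psi> y" by auto
    show "w \<in> (+) m ` F - F"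
    proof (cases "y \<in> F")
      case True
      moreover have "y + m \<notin> F" using F_le[of "y + m"] y by auto
      ultimately show ?thesis using y by (auto simp: \<psi>_def)
    next
      case False
      have "y - m \<in> F" by (rule F_mid) (use y s_big in auto)
      moreover have "y = m + (y - m)" using y s_big by auto
      ultimately show ?thesis using y False by (auto simp: \<psi>_def)
    qed
  qed
  moreover have "inj_on \<psi> {s - m<..s}"
    using F_le by (force simp: inj_on_def \<psi>_def)
  ultimately show ?thesis using s_big by (simp add: card_image)
qed

section \<open>Product sets in a field\<close>

text \<open>The starting set \<open>W\<close> is a parameter so as to cover both plain subset
  products (\<open>W = {1}\<close>) and products built on top of a stabiliser.\<close>

definition products_from :: "'a::comm_monoid_mult set \<Rightarrow> 'a set \<Rightarrow> 'a set" where
  "products_from W Y = (\<lambda>(w, Z). w * \<Prod>Z) ` (W \<times> Pow Y)"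

lemma products_from_empty [simp]: "products_from W {} = W"
  by (force simp: products_from_def)

lemma products_from_mono: "W \<subseteq> W' \<Longrightarrow> products_from W Y \<subseteq> products_from W' Y"
  by (auto simp: products_from_def)

lemma products_from_insert:
  assumes "finite Y" "y \<notin> Y"
  shows "products_from W (insert y Y) = products_from W Y \<union> (*) y ` products_from W Y"
proof -
  have "w * \<Prod>(insert y Z) = y * (w * \<Prod>Z)" if "Z \<subseteq> Y" for w Z
    using that assms by (subst prod.insert) (auto intro: finite_subset simp: ac_simps)
  then show ?thesis
    by (force simp: products_from_def Pow_insert image_Un Sigma_Un_distrib2 image_iff)
qed

lemma finite_products_from [simp]: "finite W \<Longrightarrow> finite Y \<Longrightarrow> finite (products_from W Y)"
  by (simp add: products_from_def)

lemma products_from_Un: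
  assumes "finite X" "finite Y" "X \<inter> Y = {}"
  shows "products_from (products_from W X) Y = products_from W (X \<union> Y)"
  using assms(2,3)
proof (induction Y rule: finite_induct)
  case (insert y Y)
  then have "y \<notin> X \<union> Y" by auto
  then show ?case using insert assms(1) by (simp add: products_from_insert)
qed simp

lemma products_from_invariant:
  assumes "(*) h ` W \<subseteq> W"
  shows "(*) h ` products_from W Y \<subseteq> products_from W Y"
proof
  fix x assume "x \<in> (*) h ` products_from W Y"
  then obtain w Z where wZ: "w \<in> W" "Z \<subseteq> Y" "x = (h * w) * \<Prod>Z"
    by (auto simp: products_from_def mult.assoc)
  then show "x \<in> products_from W Y"
    using assms by (auto simp: products_from_def intro!: image_eqI[of _ _ "(h * w, Z)"])
qed

lemma products_from_nonzero:
  fixes W :: "'a::field set"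
  assumes "0 \<notin> W" "0 \<notin> Y"
  shows "0 \<notin> products_from W Y"
proof
  assume "0 \<in> products_from W Y"
  then obtain w Z where wZ: "w \<in> W" "Z \<subseteq> Y" "w * \<Prod>Z = 0"
    by (auto simp: products_from_def)
  then have "\<Prod>Z = 0" using assms by auto
  \<comment> \<open>An infinite product is 1 by convention, hence nonzero too.\<close>
  then show False using wZ assms by (cases "finite Z") auto
qed

lemma invariant_image_eq:
  fixes W :: "'a::field set"
  assumes "finite W" "h \<noteq> 0" "(*) h ` W \<subseteq> W"
  shows "(*) h ` W = W"
  using assms by (intro card_subset_eq) (auto simp: card_image inj_on_def)

text \<open>Each element of \<open>Y\<close> adds a nonempty \<open>H\<close>-invariant set, hence at least one coset.\<close>

lemma card_products_from_ge:
  fixes W Y H :: "'a::field set"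
  assumes "finite Y" and W: "finite W" "0 \<notin> W" and H: "finite H" "0 \<notin> H"
    and inv: "\<And>h. h \<in> H \<Longrightarrow> (*) h ` W \<subseteq> W"
    and "0 \<notin> Y"
    and "\<And>y. y \<in> Y \<Longrightarrow> \<not> (*) y ` products_from W Y \<subseteq> products_from W Y"
  shows "card W + card H * card Y \<le> card (products_from W Y)"
  using assms(1,7,8)
proof (induction Y rule: finite_induct)
  case (insert y Y)
  let ?P = "products_from W Y" and ?Q = "products_from W (insert y Y)"
  let ?D = "(*) y ` ?P - ?P"
  have Q: "?Q = ?P \<union> (*) y ` ?P" using insert by (simp add: products_from_insert)
  \<comment> \<open>Whatever stabilises an earlier stage stabilises the later one, so the hypothesis
    on the final set passes down to \<open>?P\<close>.\<close>
  have stab: "(*) u ` ?Q \<subseteq> ?Q" if "(*) u ` ?P \<subseteq> ?P" for u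
    unfolding Q using that by (force simp: image_Un image_image mult.left_commute)
  have IH: "card W + card H * card Y \<le> card ?P"
  proof (rule insert.IH)
    show "\<not> (*) u ` ?P \<subseteq> ?P" if "u \<in> Y" for u
      using stab[of u] insert.prems(2)[of u] that by blast
  qed (use insert.prems in auto)
  have "?D \<noteq> {}"
  proof
    assume "?D = {}"
    then have "(*) y ` ?P \<subseteq> ?P" by auto
    then show False using stab insert.prems(2)[of y] by blast
  qed
  then obtain d where d: "d \<in> ?D" by auto
  have fP: "finite ?P" and nP: "0 \<notin> ?P"
    using W insert products_from_nonzero[of W Y] by auto
  have d0: "d \<noteq> 0" using d nP insert.prems(1) by auto
  \<comment> \<open>Each h in \<open>H\<close> permutes \<open>?P\<close> and commutes with
    \<open>y\<close>, so it maps \<open>?D\<close> into itself.\<close>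
  have "(\<lambda>h. h * d) ` H \<subseteq> ?D"
  proof
    fix x assume "x \<in> (\<lambda>h. h * d) ` H"
    then obtain h where h: "h \<in> H" "x = h * d" by auto
    have hP: "(*) h ` ?P = ?P"
      using products_from_invariant[OF inv] h H fP by (intro invariant_image_eq) auto
    obtain p where p: "p \<in> ?P" "d = y * p" using d by auto
    have "h * p \<in> ?P" using hP p by auto
    then have "x \<in> (*) y ` ?P" using p h by (auto simp: mult.left_commute)
    moreover have "x \<notin> ?P"
    proof
      assume "x \<in> ?P"
      then obtain q where "q \<in> ?P" "h * d = h * q" using hP h by (metis imageE)
      then show False using h H d by auto
    qed
    ultimately show "x \<in> ?D" by simp
  qed
  then have "card H \<le> card ?D"
    using fP d0 by (intro card_inj_on_le[of "\<lambda>h. h * d"]) (auto simp: inj_on_def)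
  moreover have "card ?Q = card ?P + card ?D"
    unfolding Q using fP by (subst card_Un_disjoint[symmetric]) auto
  ultimately show ?case using IH insert by simp
qed simp

section \<open>Double counting and greedy growth\<close>

text \<open>Count pairs (c, x) with x and c * x in \<open>S\<close>. Each c yields at least card S -
  d of them, while (x, c * x) determines c and is off the diagonal because
  \<open>1 \<notin> C\<close>.\<close>

lemma card_translates_double_count:
  fixes C S :: "'a::field set"
  assumes "finite C" "1 \<notin> C" and S: "finite S" "0 \<notin> S"
    and few: "\<And>c. c \<in> C \<Longrightarrow> card ((*) c ` S - S) \<le> d"
    and c0: "0 \<notin> C"
  shows "card C * card S \<le> card C * d + card S * (card S - 1)"
proof -
  let ?T = "SIGMA c:C. {x \<in> S. c * x \<in> S}"
  have "card S \<le> d + card {x \<in> S. c * x \<in> S}" if "c \<in> C" for c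
  proof -
    have "(*) c ` S = ((*) c ` S - S) \<union> (*) c ` {x \<in> S. c * x \<in> S}" by auto
    then have "card ((*) c ` S) \<le> card ((*) c ` S - S) + card ((*) c ` {x \<in> S. c * x \<in> S})"
      by (metis card_Un_le)
    moreover have "card ((*) c ` S) = card S"
      using that c0 by (intro card_image) (auto simp: inj_on_def)
    moreover have "card ((*) c ` {x \<in> S. c * x \<in> S}) \<le> card {x \<in> S. c * x \<in> S}"
      using S by (intro card_image_le) auto
    ultimately show ?thesis using few[OF that] by linarith
  qed
  then have "(\<Sum>c\<in>C. card S) \<le> (\<Sum>c\<in>C. d + card {x \<in> S. c * x \<in> S})"
    by (rule sum_mono)
  also have "\<dots> = card C * d + card ?T"
    using assms by (subst card_SigmaI) (auto simp: sum.distrib)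
  also have "card ?T \<le> card (SIGMA x:S. S - {x})"
  proof (rule card_inj_on_le)
    show "inj_on (\<lambda>(c, x). (x, c * x)) ?T" using S by (auto simp: inj_on_def)
    show "(\<lambda>(c, x). (x, c * x)) ` ?T \<subseteq> (SIGMA x:S. S - {x})" using assms by auto
  qed (use S in auto)
  also have "\<dots> = card S * (card S - 1)"
    using S by (subst card_SigmaI) (auto simp: card_Diff_singleton_if)
  finally show ?thesis by simp
qed

text \<open>If every c in \<open>B - X\<close> gained at most \<open>d\<close> products, the double
  count would contradict \<open>less\<close>.\<close>

lemma large_increment_exists:
  fixes B X :: "'a::field set"
  assumes B: "finite B" "0 \<notin> B" "1 \<notin> B" and X: "X \<subseteq> B"
    and less: "card (products_from {1} X) * (card (products_from {1} X) - 1)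
             + card (B - X) * d < card (B - X) * card (products_from {1} X)"
  obtains c where "c \<in> B - X"
    "card (products_from {1} (insert c X)) \<ge> card (products_from {1} X) + d + 1"
proof -
  let ?S = "products_from {1} X"
  have fX: "finite X" using B X finite_subset by auto
  have S: "finite ?S" "0 \<notin> ?S"
    using fX B X products_from_nonzero[of "{1}" X] by auto
  have "\<exists>c \<in> B - X. \<not> card ((*) c ` ?S - ?S) \<le> d"
  proof (rule ccontr)
    assume "\<not> ?thesis"
    then have "card (B - X) * card ?S \<le> card (B - X) * d + card ?S * (card ?S - 1)"
      using B S by (intro card_translates_double_count) auto
    then show False using less by linarith
  qed
  then obtain c where c: "c \<in> B - X" "\<not> card ((*) c ` ?S - ?S) \<le> d" by auto
  have "card (products_from {1} (insert c X)) = card ?S + card ((*) c ` ?S - ?S)"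
    using c fX S by (subst card_Un_disjoint[symmetric]) (auto simp: products_from_insert)
  then show ?thesis using that c by force
qed

lemma card_products_from_insert_le:
  assumes "finite X" "c \<notin> X" "finite W"
  shows "card (products_from W (insert c X)) \<le> 2 * card (products_from W X)"
  using card_Un_le[of "products_from W X" "(*) c ` products_from W X"] assms
    card_image_le[of "products_from W X" "(*) c"]
  by (simp add: products_from_insert)

text \<open>With q = 2^j \<le> 4 products, q(q - 1) \<le> 12 is below \<open>card B - j\<close>, so
  some element gains more than q - 1 products, that is, all q. The case j = 2 explains the
  15.\<close>

lemma doubling_subset_exists:
  fixes B :: "'a::field set"
  assumes B: "finite B" "0 \<notin> B" "1 \<notin> B" "card B \<ge> 15"
    and "j \<le> 3"
  shows "\<exists>X\<subseteq>B. card X = j \<and> card (products_from {1} X) = 2 ^ j"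
  using assms(5)
proof (induction j)
  case 0
  show ?case by (intro exI[of _ "{}"]) auto
next
  case (Suc j)
  then obtain X where X: "X \<subseteq> B" "card X = j" "card (products_from {1} X) = 2 ^ j" by auto
  have fX: "finite X" using B X finite_subset by auto
  have cd: "card (B - X) = card B - j" using X fX by (simp add: card_Diff_subset)
  have j: "j = 0 \<or> j = 1 \<or> j = 2" using Suc by auto
  define q :: nat where "q = 2 ^ j"
  have q: "q * (q - 1) < card B - j" "q \<ge> 1"
    using j B(4) by (auto simp: q_def)
  have "(card B - j) * q = (card B - j) * (q - 1) + (card B - j)"
    using q(2) by (cases q) auto
  then have "q * (q - 1) + (card B - j) * (q - 1) < (card B - j) * q"
    using q(1) by linarith
  then obtain c where c: "c \<in> B - X"
    "card (products_from {1} (insert c X)) \<ge> q + (q - 1) + 1"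
    using large_increment_exists[OF B(1-3) X(1), of "q - 1"] X(3) cd unfolding q_def by metis
  have "card (products_from {1} (insert c X)) \<le> 2 * q"
    using card_products_from_insert_le[of X c "{1}"] c fX X by (simp add: q_def)
  then have "card (products_from {1} (insert c X)) = 2 ^ Suc j"
    using c q by (simp add: q_def)
  moreover have "insert c X \<subseteq> B" "card (insert c X) = Suc j" using c X fX by auto
  ultimately show ?case by blast
qed

text \<open>Three elements with 8 products start the induction (5 * 3 = 8 + 7); each further element
  can be chosen to add at least five.\<close>

lemma fast_growing_subset_exists:
  fixes B :: "'a::field set"
  assumes B: "finite B" "0 \<notin> B" "1 \<notin> B" and k: "card B \<ge> 2 * E + 4" "card B \<ge> 36"
    and slow: "\<And>X. X \<subseteq> B \<Longrightarrow> card (products_from {1} X) \<le> card X + E + 1"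
    and "3 \<le> j" "j \<le> E div 4 + 3"
  shows "\<exists>X\<subseteq>B. card X = j \<and> 5 * j \<le> card (products_from {1} X) + 7"
  using assms(7,8)
proof (induction j rule: dec_induct)
  case base
  obtain X where "X \<subseteq> B" "card X = 3" "card (products_from {1} X) = 2 ^ 3"
    using doubling_subset_exists[OF B, of 3] k by auto
  then show ?case by (intro exI[of _ X]) auto
next
  case (step j)
  then obtain X where X: "X \<subseteq> B" "card X = j" "5 * j \<le> card (products_from {1} X) + 7" by auto
  have fX: "finite X" using B X finite_subset by auto
  have cd: "card (B - X) = card B - j" using X fX by (simp add: card_Diff_subset)
  define s where "s = card (products_from {1} X)"
  have s8: "s \<ge> 8" using X step by (simp add: s_def)
  have "s \<le> j + E + 1" using slow[OF X(1)] X by (simp add: s_def)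
  \<comment> \<open>As j \<le> E/4 + 2, it suffices that card B \<ge> 3E/2 + 12. For E \<ge> 16 this
    follows from 2E + 4, for E \<le> 16 from 36.\<close>
  then have "card B - j \<ge> s + 7" using step k by linarith
  moreover obtain t where t: "s = t + 8" using s8 by (metis add.commute le_Suc_ex)
  moreover define u where "u = card B - j - (s + 7)"
  ultimately have u: "card B - j = t + 15 + u" by simp
  \<comment> \<open>With at least s + 7 candidates the margin is (s + 7)(s - 4) - s(s - 1) = 4s -
    28, positive since s \<ge> 8.\<close>
  have "s * (s - 1) + (card B - j) * 4 < (card B - j) * s"
    unfolding u t by (simp add: algebra_simps)
  then obtain c where c: "c \<in> B - X" "card (products_from {1} (insert c X)) \<ge> s + 4 + 1"
    using large_increment_exists[OF B(1-3) X(1), of 4] cd by (auto simp: s_def)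
  have "insert c X \<subseteq> B" "card (insert c X) = Suc j" using c X fX by auto
  moreover have "5 * Suc j \<le> card (products_from {1} (insert c X)) + 7"
    using c X by (simp add: s_def)
  ultimately show ?case by blast
qed

text \<open>
  Let \<open>H\<close> be the stabiliser of the set of products. If \<open>B\<close> meets both \<open>H\<close> and its complement,
  counting cosets gives too many products; if \<open>B\<close> misses \<open>H\<close>, every element of \<open>B\<close> adds at
  least one product and the first few, chosen greedily, add five each.
\<close>

theorem few_products_stabilised:
  fixes B :: "'a::field set"
  assumes B: "finite B" "0 \<notin> B" "1 \<notin> B" and k: "card B \<ge> 2 * E + 4" "card B \<ge> 36"
    and few: "card (products_from {1} B) \<le> card B + 1 + E"
    and "b \<in> B"
  shows "(*) b ` products_from {1} B = products_from {1} B"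
proof -
  let ?S = "products_from {1} B"
  have S: "finite ?S" "0 \<notin> ?S" using B products_from_nonzero[of "{1}" B] by auto
  have one: "1 \<in> ?S" by (force simp: products_from_def)
  define H where "H = {h. h \<noteq> 0 \<and> (*) h ` ?S \<subseteq> ?S}"
  have HS: "H \<subseteq> ?S" using one by (force simp: H_def)
  then have H: "finite H" "0 \<notin> H" using S finite_subset by auto
  have H1: "1 \<in> H" by (auto simp: H_def)
  have Hmult: "(*) h ` H \<subseteq> H" if "h \<in> H" for h
    using that by (force simp: H_def image_subset_iff mult.assoc)
  define R where "R = B - H"
  have R: "finite R" "0 \<notin> R" "R \<subseteq> B" using B by (auto simp: R_def)
  have rk: "card (B \<inter> H) + card R = card B"
    using card_Int_Diff[OF B(1), of H] by (simp add: R_def)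
  have "R = {}"
  proof (rule ccontr)
    assume "R \<noteq> {}"
    then have r1: "card R \<ge> 1" using R by (simp add: Suc_le_eq card_gt_0_iff)
    \<comment> \<open>Products from \<open>B \<inter> H\<close> stay in \<open>H\<close>, and
      \<open>H\<close> stabilises \<open>?S\<close>, so starting from all of \<open>H\<close> gives
      nothing new.\<close>
    have HPR: "products_from H R = ?S"
    proof
      show "products_from H R \<subseteq> ?S"
      proof
        fix x assume "x \<in> products_from H R"
        then obtain h Z where hZ: "h \<in> H" "Z \<subseteq> R" "x = h * \<Prod>Z"
          by (auto simp: products_from_def)
        then have "\<Prod>Z \<in> ?S" using R by (force simp: products_from_def)
        then show "x \<in> ?S" using hZ by (auto simp: H_def)
      qed
      have "products_from {1} (B \<inter> H) \<subseteq> H"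
      proof -
        have "products_from {1} Y \<subseteq> H" if "finite Y" "Y \<subseteq> H" for Y
          using that
        proof (induction Y rule: finite_induct)
          case (insert y Y)
          then have "(*) y ` products_from {1} Y \<subseteq> H" using Hmult[of y] by fastforce
          then show ?case using insert by (simp add: products_from_insert)
        qed (use H1 in simp)
        then show ?thesis using B by simp
      qed
      moreover have "?S = products_from (products_from {1} (B \<inter> H)) R"
        by (subst products_from_Un) (use B R in \<open>auto simp: R_def Int_Diff_Un\<close>)
      ultimately show "?S \<subseteq> products_from H R"
        by (metis products_from_mono)
    qed
    have "card H + card H * card R \<le> card (products_from H R)"
    proof (rule card_products_from_ge)
      fix y assume "y \<in> R"
      then show "\<not> (*) y ` products_from H R \<subseteq> products_from H R"
        using R unfolding HPR by (auto simp: R_def H_def)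
    qed (use R H Hmult in auto)
    then have HR: "card H * (card R + 1) \<le> card B + 1 + E" using few HPR by simp
    have "insert 1 (B \<inter> H) \<subseteq> H" using H1 by auto
    then have Hge: "card (B \<inter> H) + 1 \<le> card H"
      using card_mono[OF H(1)] B by (metis IntD1 Suc_eq_plus1 card_insert_disjoint finite_Int)
    show False
    proof (cases "B \<inter> H = {}")
      case False
      then have b1: "card (B \<inter> H) \<ge> 1" using B by (simp add: Suc_le_eq card_gt_0_iff)
      \<comment> \<open>The coset count becomes pq + p + q + 1 \<le> E, although card B = p + q + 2
        is at least 2E + 4.\<close>
      obtain p q where pq: "card (B \<inter> H) = p + 1" "card R = q + 1"
        using b1 r1 by (metis add.commute le_Suc_ex)
      have "(p + 2) * (q + 2) \<le> card H * (card R + 1)"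
        using Hge pq by (intro mult_mono) auto
      then have "(p + 2) * (q + 2) \<le> p + q + 3 + E" using HR rk pq by linarith
      then have "p + q + 1 \<le> E" by (simp add: algebra_simps)
      then show False using k rk pq by linarith
    next
      case True
      \<comment> \<open>No element of \<open>B\<close> stabilises \<open>?S\<close>, so each one
        outside \<open>X\<close> adds at least one product; the total bounds what \<open>X\<close>
        can have produced.\<close>
      have slow: "card (products_from {1} X) \<le> card X + E + 1" if "X \<subseteq> B" for X
      proof -
        have fX: "finite X" using that B finite_subset by auto
        have eq: "products_from (products_from {1} X) (B - X) = ?S"
          using that B fX by (subst products_from_Un) (auto simp: Un_absorb1)
        have "card (products_from {1} X) + card {1::'a} * card (B - X) \<le> card ?S"
          unfolding eq[symmetric]
        proof (rule card_products_from_ge)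
          fix y assume "y \<in> B - X"
          then show "\<not> (*) y ` products_from (products_from {1} X) (B - X)
              \<subseteq> products_from (products_from {1} X) (B - X)"
            unfolding eq using True B by (auto simp: H_def)
        qed (use B fX that products_from_nonzero[of "{1}" X] in auto)
        moreover have "card (B - X) = card B - card X" "card X \<le> card B"
          using that B fX by (auto simp: card_Diff_subset card_mono)
        ultimately show ?thesis using few by simp
      qed
      \<comment> \<open>The greedy set of size q + 3 has at least 5q + 8 products, but
        \<open>slow\<close> allows only q + 4 + E, forcing 4q + 4 \<le> E.\<close>
      define q where "q = E div 4"
      have q: "E < 4 * q + 4" unfolding q_def by presburger
      obtain X where X: "X \<subseteq> B" "card X = q + 3" "5 * (q + 3) \<le> card (products_from {1} X) + 7"
        using fast_growing_subset_exists[OF B k slow, of "q + 3"] by (auto simp: q_def)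
      have "5 * q + 8 \<le> card (products_from {1} X)" using X(3) by simp
      moreover have "card (products_from {1} X) \<le> q + 4 + E" using slow[OF X(1)] X(2) by simp
      ultimately show False using q by simp
    qed
  qed
  then have "b \<in> H" using \<open>b \<in> B\<close> by (auto simp: R_def)
  then show ?thesis using S by (intro invariant_image_eq) (auto simp: H_def)
qed

section \<open>From real sums to the circle and back\<close>

text \<open>Multiplication by \<open>b\<close> permutes \<open>S\<close>, so \<open>\<Prod>S\<close>
  equals b^(card S) times itself and cancels.\<close>

lemma power_card_eq_1:
  fixes S :: "'a::field set"
  assumes "finite S" "0 \<notin> S" "(*) b ` S = S" "b \<noteq> 0"
  shows "b ^ card S = 1"
proof -
  have "\<Prod>S = (\<Prod>x\<in>S. b * x)"
    using assms by (subst (1) assms(3)[symmetric], subst prod.reindex) (auto simp: inj_on_def)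
  also have "\<dots> = b ^ card S * \<Prod>S" by (simp add: prod.distrib)
  finally show ?thesis using assms by simp
qed

lemma cis_2pi_mult_eq_1_iff: "cis (2 * pi * x) = 1 \<longleftrightarrow> x \<in> \<int>"
proof
  assume "cis (2 * pi * x) = 1"
  then have "cos (2 * pi * x) = 1" by (metis cis.sel(1) one_complex.sel(1))
  then obtain n :: int where "2 * pi * x = real_of_int n * 2 * pi"
    unfolding cos_one_2pi_int by blast
  then have "x = n" by simp
  then show "x \<in> \<int>" by simp
qed simp

text \<open>This realises the reals modulo \<open>a\<close> inside the complex field, where the
  product lemmas apply.\<close>

lemma cis_2pi_div_eq_iff:
  "cis (2 * pi * x / a) = cis (2 * pi * y / a) \<longleftrightarrow> (x - y) / a \<in> \<int>"
proof -
  have "cis (2 * pi * x / a) = cis (2 * pi * y / a) \<longleftrightarrow>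
      cis (2 * pi * x / a) / cis (2 * pi * y / a) = 1" by simp
  also have "\<dots> \<longleftrightarrow> cis (2 * pi * ((x - y) / a)) = 1"
    by (simp add: cis_divide diff_divide_distrib right_diff_distrib)
  finally show ?thesis by (simp only: cis_2pi_mult_eq_1_iff)
qed

lemma prod_cis: "finite X \<Longrightarrow> (\<Prod>x\<in>X. cis (c * x / a)) = cis (c * (\<Sum>X) / a)"
  by (induction X rule: finite_induct) (auto simp: cis_mult distrib_left add_divide_distrib)

lemma FS_eq_image: "FS A = sum (\<lambda>x. x) ` Pow A"
  by (auto simp: FS_def)

lemma FS_insert:
  assumes "finite B" "a \<notin> B"
  shows "FS (insert a B) = FS B \<union> (+) a ` FS B"
proof -
  have "\<Sum>(insert a X) = a + \<Sum>X" if "X \<subseteq> B" for X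
    using that assms by (subst sum.insert) (auto intro: finite_subset)
  then show ?thesis
    by (force simp: FS_eq_image Pow_insert image_Un image_iff)
qed

text \<open>Injectivity keeps factors from merging when products run over the image set.\<close>

lemma cis_image_FS:
  assumes "finite B" "inj_on (\<lambda>x. cis (c * x / a)) B"
  shows "(\<lambda>x. cis (c * x / a)) ` FS B = products_from {1} ((\<lambda>x. cis (c * x / a)) ` B)"
proof -
  let ?f = "\<lambda>x. cis (c * x / a)"
  have "\<Prod>(?f ` X) = ?f (\<Sum>X)" if "X \<subseteq> B" for X
    using inj_on_subset[OF assms(2) that] finite_subset[OF that assms(1)]
    by (simp add: prod.reindex prod_cis)
  moreover have "Pow (?f ` B) = image ?f ` Pow B"
    by (simp add: image_Pow_surj)
  ultimately show ?thesis
    by (force simp: products_from_def FS_eq_image image_iff)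
qed

text \<open>In each class modulo \<open>a\<close>, the largest element of \<open>F\<close> plus
  \<open>a\<close> is new and stays in the class.\<close>

lemma card_cis_image_le:
  fixes F :: "real set"
  assumes "finite F" "a > 0"
  shows "card ((\<lambda>x. cis (2 * pi * x / a)) ` F) \<le> card ((+) a ` F - F)"
proof (rule surj_card_le)
  let ?f = "\<lambda>x. cis (2 * pi * x / a)"
  show "finite ((+) a ` F - F)" using assms by simp
  show "?f ` F \<subseteq> ?f ` ((+) a ` F - F)"
  proof
    fix z assume "z \<in> ?f ` F"
    then obtain x where x: "x \<in> F" "z = ?f x" by auto
    define K where "K = {y \<in> F. ?f y = ?f x}"
    have K: "finite K" "K \<noteq> {}" using x assms by (auto simp: K_def)
    have MK: "Max K \<in> K" using Max_in K by blast
    have f: "?f (a + Max K) = ?f (Max K)"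
      unfolding cis_2pi_div_eq_iff using assms by simp
    have "a + Max K \<notin> F"
    proof
      assume "a + Max K \<in> F"
      then have "a + Max K \<in> K" using f MK by (simp add: K_def)
      then show False using Max_ge[OF K(1)] assms by fastforce
    qed
    then show "z \<in> ?f ` ((+) a ` F - F)"
      using f MK x by (intro image_eqI[of _ _ "a + Max K"]) (auto simp: K_def)
  qed
qed

lemma dilate_insert: "dilate t (insert x X) = insert (t * x) (dilate t X)"
  by (auto simp: dilate_def)

lemma card_new_sums_dilate:
  assumes t: "t > 0" and J: "J \<subseteq> {1..<m}"
    and dense: "card J \<ge> 2 * (m - 1 - card J) + 4" "card J \<ge> 9"
  shows "card (FS (insert (t * real m) (dilate t (real ` J))) - FS (dilate t (real ` J))) = m"
proof -
  let ?g = "\<lambda>x. t * real x" and ?F = "sum (\<lambda>x. x) ` Pow J"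
  have fJ: "finite J" using J finite_subset by blast
  have inj: "inj ?g" using t by (auto simp: inj_on_def)
  have dil: "dilate t (real ` J) = ?g ` J" by (auto simp: dilate_def)
  have "\<Sum>(?g ` X) = ?g (\<Sum>X)" if "X \<subseteq> J" for X
    using inj by (subst sum.reindex) (auto intro: inj_on_subset simp: sum_distrib_left)
  then have FS: "FS (?g ` J) = ?g ` ?F"
    unfolding FS_eq_image image_Pow_surj[OF refl, symmetric] image_image by auto
  have "?g m \<notin> ?g ` J" using J t by auto
  then have "FS (insert (?g m) (?g ` J)) - FS (?g ` J) = (+) (?g m) ` ?g ` ?F - ?g ` ?F"
    using FS_insert[of "?g ` J" "?g m"] fJ unfolding FS by blast
  also have "(+) (?g m) ` ?g ` ?F = ?g ` (+) m ` ?F"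
    by (simp add: image_image distrib_left)
  also have "?g ` (+) m ` ?F - ?g ` ?F = ?g ` ((+) m ` ?F - ?F)"
    using inj by (simp add: image_set_diff)
  finally have "card (FS (insert (?g m) (?g ` J)) - FS (?g ` J)) = card ((+) m ` ?F - ?F)"
    using inj by (simp add: card_image inj_on_subset)
  then show ?thesis
    using card_new_subset_sums_dense[OF J dense] by (simp add: dil)
qed

text \<open>Few new sums mean few classes modulo \<open>a\<close>. The image \<open>S\<close> of
  \<open>FS B\<close> is then stable under every \<open>?f b\<close>, so \<open>?f b ^ m = 1\<close>
  with m = card S, and b is a multiple of a / m.\<close>

lemma few_new_sums_imp_dilate:
  assumes B: "finite B" "B \<subseteq> {0<..<a}" and a: "a > 0"
    and k: "card B \<ge> 2 * E + 4" "card B \<ge> 36"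
    and few: "card (FS (insert a B) - FS B) \<le> card B + 1 + E"
  obtains m J where "m > 0" "m \<le> card B + 1 + E" "J \<subseteq> {1..<m}" "B = dilate (a / real m) (real ` J)"
proof -
  let ?f = "\<lambda>x. cis (2 * pi * x / a)"
  define S where "S = products_from {1} (?f ` B)"
  \<comment> \<open>Applied to differences of points of [0, a): distinct ones lie in distinct
    classes, so \<open>?f\<close> is injective on \<open>B\<close> and avoids 1.\<close>
  have no_int: "r \<notin> \<int>" if "0 < \<bar>r\<bar>" "\<bar>r\<bar> < 1" for r :: real
    using that by (auto elim!: Ints_cases)
  have inj: "inj_on ?f B"
  proof (rule inj_onI, rule ccontr)
    fix x y assume xy: "x \<in> B" "y \<in> B" "?f x = ?f y" "x \<noteq> y"
    then have "0 < x" "0 < y" "x < a" "y < a" using B by auto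
    then have "0 < \<bar>(x - y) / a\<bar>" "\<bar>(x - y) / a\<bar> < 1" using xy a by (auto simp: abs_less_iff field_simps)
    then show False using no_int xy cis_2pi_div_eq_iff by blast
  qed
  have "a \<notin> B" using B by auto
  then have "FS (insert a B) - FS B = (+) a ` FS B - FS B" using B by (auto simp: FS_insert)
  moreover have "S = ?f ` FS B" unfolding S_def using B inj by (simp add: cis_image_FS)
  moreover have "finite (FS B)" using B by (simp add: FS_eq_image)
  ultimately have S_le: "card S \<le> card B + 1 + E"
    using card_cis_image_le[of "FS B" a] a few by simp
  have cB: "card (?f ` B) = card B" using inj by (rule card_image)
  have f1: "1 \<notin> ?f ` B"
  proof
    assume "1 \<in> ?f ` B"
    then obtain x where x: "x \<in> B" "?f x = ?f 0" by auto
    then have "0 < x" "x < a" using B by auto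
    then have "0 < \<bar>(x - 0) / a\<bar>" "\<bar>(x - 0) / a\<bar> < 1" by auto
    then show False using no_int x cis_2pi_div_eq_iff by blast
  qed
  have f0: "0 \<notin> ?f ` B" by auto
  have S: "finite S" "0 \<notin> S" "1 \<in> S"
    using B products_from_nonzero[of "{1}" "?f ` B"] f0
    by (auto simp: S_def products_from_def intro!: image_eqI[of _ _ "(1, {})"])
  define m where "m = card S"
  have m: "m > 0" using S by (auto simp: m_def card_gt_0_iff)
  define J where "J = {j. a / real m * real j \<in> B}"
  have grid: "\<exists>j. j \<in> J \<and> b = a / real m * real j" if "b \<in> B" for b
  proof -
    have b: "0 < b" "b < a" using that B by auto
    have "(*) (?f b) ` S = S"
      unfolding S_def
      by (rule few_products_stabilised[of _ E]) (use B f0 f1 k S_le cB that in \<open>auto simp: S_def\<close>)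
    then have "?f b ^ m = 1"
      unfolding m_def using S by (intro power_card_eq_1) auto
    then have "cis (2 * pi * (real m * b / a)) = 1" by (simp add: DeMoivre mult_ac)
    then obtain z :: int where z: "real m * b / a = z"
      unfolding cis_2pi_mult_eq_1_iff by (auto elim: Ints_cases)
    moreover have "real m * b / a > 0" using b m a by simp
    ultimately have "real m * b / a = real (nat z)" by simp
    then have "b = a / real m * real (nat z)" using m a by (simp add: field_simps)
    then show ?thesis using that by (auto simp: J_def)
  qed
  show ?thesis
  proof (rule that)
    show "J \<subseteq> {1..<m}"
    proof
      fix j assume "j \<in> J"
      then have "0 < a / real m * real j" "a / real m * real j < a" using B by (auto simp: J_def)
      then have "0 < j" "j < m" using m a by (auto simp: field_simps zero_less_mult_iff)
      then show "j \<in> {1..<m}" by auto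
    qed
    show "B = dilate (a / real m) (real ` J)"
    proof
      show "B \<subseteq> dilate (a / real m) (real ` J)"
        using grid unfolding dilate_def by blast
    qed (auto simp: dilate_def J_def)
  qed (use m S_le in \<open>auto simp: m_def\<close>)
qed

section \<open>The threshold and the characterisation of the excess\<close>

text \<open>As \<open>sqrt (real E + 16) \<ge> 4\<close>, the second entry of the maximum is at
  least 1 + 65. Both size conditions on the first i - 1 elements follow.\<close>

lemma threshold_bounds:
  assumes "int i \<ge> threshold E"
  shows "i \<ge> 2 * E + 5" "i \<ge> 66"
proof -
  have "4 \<le> sqrt (real E + 16)" by (rule real_le_rsqrt) simp
  then have "65 \<le> 33 + 8 * sqrt (real E + 16)" by simp
  then have "65 \<le> \<lfloor>33 + 8 * sqrt (real E + 16)\<rfloor>" by (simp add: le_floor_iff)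
  moreover have "2 * int E + 5 \<le> int i" "1 + \<lfloor>33 + 8 * sqrt (real E + 16)\<rfloor> \<le> int i"
    using assms unfolding threshold_def by simp_all
  ultimately show "i \<ge> 2 * E + 5" "i \<ge> 66" by linarith+
qed

theorem theorem3p2:
  fixes E i :: nat and a :: "nat \<Rightarrow> real"
  assumes i_ge: "int i \<ge> threshold E"
    and a_pos: "\<And>j. j \<in> {1..i} \<Longrightarrow> a j > 0"
    and a_incr: "strict_mono_on {1..i} a"
  shows "\<forall>e\<in>{0..E}.
     (increment_excess a i = int e \<longleftrightarrow>
        (\<exists>!(t :: real, D :: nat set). t > 0 \<and> D \<subseteq> {1..i + e - 1} \<and> card D = e \<and>
           prefix_set a i = dilate t (real ` ({1..i + e} - D)))) \<and>
     (\<forall>(t :: real) (D :: nat set).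
        t > 0 \<and> D \<subseteq> {1..i + e - 1} \<and> card D = e \<and>
        prefix_set a i = dilate t (real ` ({1..i + e} - D)) \<longrightarrow>
        a i = t * real (i + e))"
proof (intro ballI)
  fix e assume "e \<in> {0..E}"
  then have eE: "e \<le> E" by simp
  note i = threshold_bounds[OF i_ge]
  define B where "B = prefix_set a (i - 1)"
  define rep where "rep = (\<lambda>t D. t > 0 \<and> D \<subseteq> {1..i + e - 1} \<and> card D = e \<and>
           prefix_set a i = dilate t (real ` ({1..i + e} - D)))"
  have less: "a j < a l" if "1 \<le> j" "j < l" "l \<le> i" for j l
    using a_incr that by (auto simp: strict_mono_on_def)
  have fB: "finite B" by (simp add: B_def prefix_set_def)
  have "{1..i} = insert i {1..i - 1}" using i by auto
  then have A: "prefix_set a i = insert (a i) B" by (simp add: prefix_set_def B_def)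
  have B_sub: "B \<subseteq> {0<..<a i}" using less[of _ i] a_pos i by (auto simp: B_def prefix_set_def)
  have "inj_on a {1..i - 1}"
    using less i by (intro linorder_inj_onI) fastforce+
  then have cB: "card B = i - 1" by (simp add: B_def prefix_set_def card_image)
  have ai: "a i > 0" using a_pos i by simp
  have excess: "increment_excess a i = int e \<longleftrightarrow> card (FS (insert (a i) B) - FS B) = i + e"
    unfolding increment_excess_def A B_def by linarith
  \<comment> \<open>\<open>i + e\<close> is not in \<open>D\<close> and \<open>B\<close> lies below
    \<open>a i\<close>, so the two maxima agree.\<close>
  have last: "a i = t * real (i + e)" if "rep t D" for t D
  proof -
    have t: "t > 0" and D: "D \<subseteq> {1..i + e - 1}"
      and eq: "insert (a i) B = dilate t (real ` ({1..i + e} - D))"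
      using that A by (auto simp: rep_def)
    have "i + e \<in> {1..i + e} - D" using D i by fastforce
    then have "t * real (i + e) \<in> insert (a i) B" unfolding eq dilate_def by blast
    then have le: "t * real (i + e) \<le> a i" using B_sub by auto
    obtain x where "x \<in> {1..i + e}" "a i = t * real x"
      using equalityD1[OF eq] by (force simp: dilate_def)
    then show ?thesis using le t by (intro antisym) auto
  qed
  \<comment> \<open>The last element fixes t; then \<open>D\<close> is recovered as a
    complement.\<close>
  have uniq: "t = t' \<and> D = D'" if "rep t D" "rep t' D'" for t t' D D'
  proof -
    have "t * real (i + e) = t' * real (i + e)" using last that by metis
    then have t: "t = t'" "t > 0" using i that by (auto simp: rep_def)
    have "inj (\<lambda>x. t * real x)" using t by (auto simp: inj_on_def)
    moreover have "(\<lambda>x. t * real x) ` ({1..i + e} - D) = (\<lambda>x. t * real x) ` ({1..i + e} - D')"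
      using that t by (auto simp: rep_def dilate_def image_image Setcompr_eq_image)
    ultimately have "{1..i + e} - D = {1..i + e} - D'" by (simp add: inj_image_eq_iff)
    moreover have "D \<subseteq> {1..i + e - 1}" "D' \<subseteq> {1..i + e - 1}"
      using that unfolding rep_def by blast+
    moreover have "{1..i + e - 1} \<subseteq> {1..i + e}" by auto
    ultimately show ?thesis using t by blast
  qed
  have "card (FS (insert (a i) B) - FS B) = i + e \<longleftrightarrow> (\<exists>t D. rep t D)"
  proof
    assume "\<exists>t D. rep t D"
    then obtain t D where r: "rep t D" by blast
    then have t: "t > 0" and D: "D \<subseteq> {1..i + e - 1}" "card D = e"
      and eq: "insert (a i) B = dilate t (real ` ({1..i + e} - D))"
      using A by (auto simp: rep_def)
    define J where "J = {1..<i + e} - D"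
    have fD: "finite D" using D finite_subset by blast
    have "{1..i + e} - D = insert (i + e) J" using D i by (fastforce simp: J_def)
    moreover have "dilate t (real ` insert (i + e) J) = insert (a i) (dilate t (real ` J))"
      unfolding last[OF r] by (simp add: dilate_insert)
    ultimately have "insert (a i) B = insert (a i) (dilate t (real ` J))"
      using eq by simp
    moreover have "a i \<notin> B" using B_sub by auto
    moreover have "a i \<notin> dilate t (real ` J)"
      unfolding last[OF r] using t by (auto simp: dilate_def J_def)
    ultimately have BJ: "B = dilate t (real ` J)" by (metis insert_ident)
    have cJ: "card J = i - 1"
    proof -
      have "D \<subseteq> {1..<i + e}" using D i by fastforce
      then show ?thesis using D fD by (simp add: J_def card_Diff_subset)
    qed
    \<comment> \<open>\<open>J\<close> misses exactly \<open>e\<close> elements of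
      \<open>{1..<i + e}\<close>, so density reads i - 1 \<ge> 2e + 4, which is supplied by i \<ge>
      2E + 5.\<close>
    show "card (FS (insert (a i) B) - FS B) = i + e"
      unfolding last[OF r] BJ
      by (rule card_new_sums_dilate) (use t cJ i eE in \<open>auto simp: J_def\<close>)
  next
    assume N: "card (FS (insert (a i) B) - FS B) = i + e"
    have "card (FS (insert (a i) B) - FS B) \<le> card B + 1 + e" "card B \<ge> 2 * e + 4" "card B \<ge> 36"
      using N cB i eE by auto
    then obtain m J where mJ: "m > 0" "m \<le> card B + 1 + e" "J \<subseteq> {1..<m}"
      "B = dilate (a i / real m) (real ` J)"
      using few_new_sums_imp_dilate[OF fB B_sub ai, of e] by blast
    let ?t = "a i / real m"
    have t: "?t > 0" using ai mJ by simp
    have "inj_on (\<lambda>x. ?t * real x) J" using t by (auto simp: inj_on_def)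
    moreover have "B = (\<lambda>x. ?t * real x) ` J" unfolding mJ(4) by (auto simp: dilate_def)
    ultimately have cJ: "card J = i - 1" using cB card_image by metis
    have fJ: "finite J" using mJ finite_subset by blast
    have "card J \<le> m - 1" using card_mono[OF _ mJ(3)] by simp
    \<comment> \<open>So far only m \<le> i + e is known. Hence \<open>J\<close> misses at most
      \<open>e\<close> elements of \<open>{1..<m}\<close> and is dense; its count of
      \<open>m\<close> new sums, compared with \<open>N\<close>, gives equality.\<close>
    then have "card (FS (insert (?t * real m) (dilate ?t (real ` J))) - FS (dilate ?t (real ` J))) = m"
      using t mJ cJ cB i eE by (intro card_new_sums_dilate) auto
    then have m: "m = i + e" using N mJ by simp
    define D where "D = {1..<m} - J"
    have "rep ?t D"
      unfolding rep_def
    proof (intro conjI)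
      show "D \<subseteq> {1..i + e - 1}" using m by (auto simp: D_def)
      show "card D = e" using mJ m cJ i fJ by (simp add: D_def card_Diff_subset)
      have "{1..i + e} - D = insert m J" using m mJ by (auto simp: D_def)
      moreover have "insert (a i) B = insert (?t * real m) (dilate ?t (real ` J))"
        using mJ by simp
      ultimately show "prefix_set a i = dilate ?t (real ` ({1..i + e} - D))"
        unfolding A by (simp only: dilate_insert image_insert)
    qed (use t in simp)
    then show "\<exists>t D. rep t D" by blast
  qed
  moreover have "(\<exists>t D. rep t D) \<longleftrightarrow> (\<exists>!(t, D). rep t D)"
    using uniq by (simp add: Ex1_def) metis
  ultimately have "increment_excess a i = int e \<longleftrightarrow> (\<exists>!(t, D). rep t D)"
    using excess by simp
  then show "(increment_excess a i = int e \<longleftrightarrow>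
        (\<exists>!(t :: real, D :: nat set). t > 0 \<and> D \<subseteq> {1..i + e - 1} \<and> card D = e \<and>
           prefix_set a i = dilate t (real ` ({1..i + e} - D)))) \<and>
     (\<forall>(t :: real) (D :: nat set).
        t > 0 \<and> D \<subseteq> {1..i + e - 1} \<and> card D = e \<and>
        prefix_set a i = dilate t (real ` ({1..i + e} - D)) \<longrightarrow>
        a i = t * real (i + e))"
    using last unfolding rep_def by blast
qed

end
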